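(* Let $n,k,s$ be positive integers and let $p_0\geq p_1\geq\cdots\geq p_s>0$ be arbitrary real numbers, $\vec{p}=(p_0,\ldots,p_s)$. Set $$d_{\vec{p}}=\max_{1\leq i\leq s}\frac{i(p_0+\cdots+p_s)}{p_1+\cdots+p_i}.$$ If $n\geq\max\{(s+1)k,\ \lceil d_{\vec{p}}\rceil k\}$, then $$f_{\vec{p}}(n,k,s)=(p_1+\cdots+p_s)\binom{n}{k}.$$
   Context: $[n]=\{1,\ldots,n\}$ and $\binom{[n]}{k}$ is the collection of all $k$-element subsets of $[n]$. For families $\mathcal{A}_1,\ldots,\mathcal{A}_m\subseteq 2^{[n]}$ the rainbow matching number $\nu(\mathcal{A}_1,\ldots,\mathcal{A}_m)$ is the maximum integer $r$ such that there are indices $1\leq i_1<\cdots<i_r\leq m$ and pairwise disjoint sets $A_{i_1}\in\mathcal{A}_{i_1},\ldots,A_{i_r}\in\mathcal{A}_{i_r}$. A sequence of $s+1$ families $\mathcal{B}_0,\mathcal{B}_1,\ldots,\mathcal{B}_s\subseteq 2^{[n]}$ is called overlapping if $\nu(\mathcal{B}_0,\ldots,\mathcal{B}_s)\leq s$, i.e. one cannot choose pairwise disjoint sets $B_i\in\mathcal{B}_i$, $i=0,\ldots,s$. For real constants $p_0\geq p_1\geq\cdots\geq p_s>0$, $\vec{p}=(p_0,\ldots,p_s)$ and $n\geq (s+1)k$, define $$f_{\vec{p}}(n,k,s)=\max\left\{\sum_{i=0}^s p_i|\mathcal{B}_i| : \mathcal{B}_0\subseteq\mathcal{B}_1\subseteq\cdots\subseteq\mathcal{B}_s\subseteq\binom{[n]}{k}\text{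 are overlapping}\right\}$$ (families may be empty and may coincide). *)

theory Defs
  imports Complex_Main "HOL-Library.Disjoint_Sets" "HOL-Library.Ramsey"
begin

text \<open>The families are indexed by a finite set \<open>I\<close>; a choice of indices
  \<open>i\<^sub>1 < \<dots> < i\<^sub>r\<close> is a set \<open>J \<subseteq> I\<close> with \<open>r\<close> elements. Disjointness is required for
  distinct indices, so the empty set may be chosen for several indices.\<close>

definition rainbow_matching_number :: "'i set \<Rightarrow> ('i \<Rightarrow> 'a set set) \<Rightarrow> nat" where
  "rainbow_matching_number I F =
     Max {r. \<exists>J A. J \<subseteq> I \<and> card J = r \<and> (\<forall>j\<in>J. A j \<in> F j) \<and> disjoint_family_on A J}"

definition overlapping :: "nat \<Rightarrow> (nat \<Rightarrow> 'a set set) \<Rightarrow> bool" where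
  "overlapping s B \<longleftrightarrow> rainbow_matching_number {0..s} B \<le> s"

lemma overlapping_iff:
  "overlapping s B \<longleftrightarrow> \<not> (\<exists>A. (\<forall>i\<in>{0..s}. A i \<in> B i) \<and> disjoint_family_on A {0..s})"
proof -
  let ?R = "{r. \<exists>J A. J \<subseteq> {0..s} \<and> card J = r \<and> (\<forall>j\<in>J. A j \<in> B j) \<and> disjoint_family_on A J}"
  have sub: "?R \<subseteq> card ` Pow {0..s}" by auto
  have fin: "finite ?R" by (rule finite_subset[OF sub]) simp
  have "0 \<in> ?R" by (intro CollectI exI[of _ "{}"]) (simp add: disjoint_family_on_def)
  hence ne: "?R \<noteq> {}" by blast
  have le: "r \<le> Suc s" if "r \<in> ?R" for r
  proof -
    from that obtain J where J: "J \<subseteq> {0..s}" "card J = r" by blast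
    have "card J \<le> card {0..s}" using J(1) by (intro card_mono) auto
    thus ?thesis using J(2) by simp
  qed
  have top: "Suc s \<in> ?R \<longleftrightarrow> (\<exists>A. (\<forall>i\<in>{0..s}. A i \<in> B i) \<and> disjoint_family_on A {0..s})"
  proof
    assume "Suc s \<in> ?R"
    then obtain J A where JA: "J \<subseteq> {0..s}" "card J = Suc s"
      "\<forall>j\<in>J. A j \<in> B j" "disjoint_family_on A J" by blast
    have "J = {0..s}" using JA(1,2) by (intro card_subset_eq) auto
    with JA show "\<exists>A. (\<forall>i\<in>{0..s}. A i \<in> B i) \<and> disjoint_family_on A {0..s}" by blast
  next
    assume "\<exists>A. (\<forall>i\<in>{0..s}. A i \<in> B i) \<and> disjoint_family_on A {0..s}"
    then obtain A where "\<forall>i\<in>{0..s}. A i \<in> B i" "disjoint_family_on A {0..s}" by blast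
    thus "Suc s \<in> ?R" by (intro CollectI exI[of _ "{0..s}"] exI[of _ A]) simp
  qed
  have "overlapping s B \<longleftrightarrow> (\<forall>r\<in>?R. r \<le> s)"
    unfolding overlapping_def rainbow_matching_number_def by (rule Max_le_iff[OF fin ne])
  also have "\<dots> \<longleftrightarrow> Suc s \<notin> ?R"
  proof
    assume "\<forall>r\<in>?R. r \<le> s"
    thus "Suc s \<notin> ?R" using Suc_n_not_le_n by blast
  next
    assume n: "Suc s \<notin> ?R"
    show "\<forall>r\<in>?R. r \<le> s"
    proof
      fix r assume r: "r \<in> ?R"
      have "r \<noteq> Suc s" using n r by blast
      with le[OF r] show "r \<le> s" by linarith
    qed
  qed
  finally show ?thesis unfolding top .
qed

definition f_weighted :: "(nat \<Rightarrow> real) \<Rightarrow> nat \<Rightarrow> nat \<Rightarrow> nat \<Rightarrow> real" where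
  "f_weighted p n k s =
     Max {\<Sum>i=0..s. p i * real (card (B i)) | B :: nat \<Rightarrow> nat set set.
            mono_on {0..s} B \<and> (\<forall>i\<in>{0..s}. B i \<subseteq> nsets {1..n} k) \<and> overlapping s B}"

definition d_weighted :: "(nat \<Rightarrow> real) \<Rightarrow> nat \<Rightarrow> real" where
  "d_weighted p s = Max ((\<lambda>i. real i * (\<Sum>j=0..s. p j) / (\<Sum>j=1..i. p j)) ` {1..s})"

text \<open>The maximum in \<open>f_weighted\<close> is over a finite nonempty set.\<close>

lemma f_weighted_values:
  fixes p :: "nat \<Rightarrow> real" and n k s :: nat
  defines "V \<equiv> {\<Sum>i=0..s. p i * real (card (B i)) | B :: nat \<Rightarrow> nat set set.
            mono_on {0..s} B \<and> (\<forall>i\<in>{0..s}. B i \<subseteq> nsets {1..n} k) \<and> overlapping s B}"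
  shows "finite V" and "V \<noteq> {}"
proof -
  let ?E = "PiE {0..s} (\<lambda>_. Pow (nsets {1..n} k))"
  have "finite ?E" by (intro finite_PiE) (auto intro: finite_imp_finite_nsets)
  moreover have "V \<subseteq> (\<lambda>B. \<Sum>i=0..s. p i * real (card (B i))) ` ?E"
  proof
    fix v assume "v \<in> V"
    then obtain B where B: "v = (\<Sum>i=0..s. p i * real (card (B i)))"
      "\<forall>i\<in>{0..s}. B i \<subseteq> nsets {1..n} k" unfolding V_def by blast
    show "v \<in> (\<lambda>B. \<Sum>i=0..s. p i * real (card (B i))) ` ?E"
      by (rule image_eqI[of _ _ "restrict B {0..s}"]) (use B in auto)
  qed
  ultimately show "finite V" by (meson finite_imageI finite_subset)
  have "mono_on {0..s} (\<lambda>_. {} :: nat set set)" by (auto intro: mono_onI)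
  moreover have "overlapping s (\<lambda>_. {} :: nat set set)" by (auto simp: overlapping_iff)
  ultimately show "V \<noteq> {}" unfolding V_def by blast
qed

end

theory Submission
  imports Defs "HOL-Combinatorics.Permutations"
begin

text \<open>The upper bound is Katona's averaging argument. Fix \<open>t = \<lfloor>n/k\<rfloor>\<close> disjoint \<open>k\<close>-sets and
  move them by a permutation. If each \<open>B\<^sub>i\<close> contained more than \<open>i\<close> of the moved sets, a
  greedy choice would give a rainbow matching; so some \<open>B\<^sub>i\<close>, and by nestedness each \<open>B\<^sub>j\<close> with
  \<open>j \<le> i\<close>, contains at most \<open>i\<close> of them. The weighted number of hits is therefore at most
  \<open>i (p\<^sub>0 + \<dots> + p\<^sub>i) + t (p\<^sub>i\<^sub>+\<^sub>1 + \<dots> + p\<^sub>s)\<close>, which is at most \<open>t (p\<^sub>1 + \<dots> + p\<^sub>s)\<close> since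
  \<open>t \<ge> d\<^sub>p\<close>. Averaging over all permutations gives the bound; it is attained by
  \<open>B\<^sub>0 = \<emptyset>\<close> and all other families full.\<close>

text \<open>Representatives are chosen in order of index: those of \<open>X 0\<close>, ...,
  \<open>X (m - 1)\<close> occupy at most \<open>m\<close> elements, so \<open>X m\<close>, having
  more than \<open>m\<close>, still offers a new one.\<close>

lemma greedy_distinct_representatives:
  assumes "\<And>i. i < m \<Longrightarrow> i < card (X i)"
  shows "\<exists>f. inj_on f {..<m} \<and> (\<forall>i<m. f i \<in> X i)"
  using assms
proof (induction m)
  case 0
  show ?case by simp
next
  case (Suc m)
  then obtain f where f: "inj_on f {..<m}" "\<forall>i<m. f i \<in> X i"
    by (meson less_SucI)
  have "card (f ` {..<m}) < card (X m)"
    using Suc.prems[of m] card_image_le[of "{..<m}" f] by simp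
  then have "\<not> X m \<subseteq> f ` {..<m}"
    by (meson card_mono finite_imageI finite_lessThan not_le)
  then obtain x where x: "x \<in> X m" "x \<notin> f ` {..<m}" by blast
  have "inj_on (f(m := x)) {..<Suc m}"
    unfolding lessThan_Suc using f(1) x(2) by (auto simp: inj_on_def)
  moreover have "\<forall>i<Suc m. (f(m := x)) i \<in> X i"
    using f(2) x(1) by (auto simp: less_Suc_eq)
  ultimately show ?case by blast
qed

text \<open>If every \<open>B i\<close> were hit by more than \<open>i\<close> of the sets, the
  greedy lemma applied to the index sets of hits would give a rainbow matching. Hits are counted by
  index and not by set, so that distinct representatives give disjoint sets even where some
  \<open>D j\<close> are empty.\<close>

lemma overlapping_few_hits:
  assumes "overlapping s B" and disj: "disjoint_family_on D T"
  obtains i where "i \<le> s" and "card {j\<in>T. D j \<in> B i} \<le> i"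
proof -
  have "\<exists>i\<le>s. card {j\<in>T. D j \<in> B i} \<le> i"
  proof (rule ccontr)
    assume "\<not> ?thesis"
    then have "i < card {j\<in>T. D j \<in> B i}" if "i < Suc s" for i
      using that by (meson less_Suc_eq_le not_le)
    from greedy_distinct_representatives[OF this]
    obtain f where f: "inj_on f {..<Suc s}" "\<forall>i<Suc s. f i \<in> {j\<in>T. D j \<in> B i}"
      by blast
    have "disjoint_family_on (\<lambda>i. D (f i)) {0..s}"
      unfolding disjoint_family_on_def
    proof (intro ballI impI)
      fix i j assume ij: "i \<in> {0..s}" "j \<in> {0..s}" "i \<noteq> j"
      then have "f i \<noteq> f j" using inj_on_eq_iff[OF f(1), of i j] by auto
      moreover have "f i \<in> T" "f j \<in> T" using f(2) ij by auto
      ultimately show "D (f i) \<inter> D (f j) = {}" using disjoint_family_onD[OF disj] by blast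
    qed
    moreover have "\<forall>i\<in>{0..s}. D (f i) \<in> B i" using f(2) by auto
    ultimately have "\<not> overlapping s B"
      unfolding overlapping_iff not_not by (intro exI[of _ "\<lambda>i. D (f i)"] conjI)
    then show False using assms(1) by contradiction
  qed
  then show ?thesis using that by blast
qed

text \<open>A bijection from \<open>A\<close> to \<open>A'\<close> is glued to one between the
  complements in \<open>S\<close>, which have equal size.\<close>

lemma ex_permutes_image_eq:
  assumes "finite S" "A \<subseteq> S" "A' \<subseteq> S" "card A = card A'"
  shows "\<exists>f. f permutes S \<and> f ` A = A'"
proof -
  have fin: "finite A" "finite A'" using assms finite_subset by blast+
  obtain g where g: "bij_betw g A A'"
    using fin assms(4) finite_same_card_bij by blast
  have "card (S - A) = card (S - A')"
    using assms fin by (simp add: card_Diff_subset)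
  then obtain h where h: "bij_betw h (S - A) (S - A')"
    using assms(1) by (meson finite_Diff finite_same_card_bij)
  let ?f = "\<lambda>x. if x \<in> A then g x else h x"
  have fA: "bij_betw ?f A A'" using g by (simp cong: bij_betw_cong)
  moreover have "bij_betw ?f (S - A) (S - A')"
    using h by (subst bij_betw_cong[where g = h]) auto
  ultimately have "bij_betw ?f (A \<union> (S - A)) (A' \<union> (S - A'))"
    by (rule bij_betw_combine) auto
  then have "bij_betw ?f S S"
    using assms(2,3) by (simp add: Un_absorb1)
  \<comment> \<open>\<open>permutes\<close> demands the identity outside \<open>S\<close>, where
    \<open>?f\<close> is arbitrary.\<close>
  then have "restrict_id ?f S permutes S" by (rule permutes_restrict_id)
  moreover have "restrict_id ?f S ` A = ?f ` A"
    using assms(2) by (intro image_cong) auto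
  then have "restrict_id ?f S ` A = A'"
    using bij_betw_imp_surj_on[OF fA] by simp
  ultimately show ?thesis by blast
qed

text \<open>Composing on the left with a permutation that carries \<open>A\<close> to
  \<open>A'\<close> maps the first set bijectively onto the second.\<close>

lemma card_permutes_image_eq:
  assumes "finite S" "A \<in> nsets S k" "A' \<in> nsets S k"
  shows "card {\<pi>. \<pi> permutes S \<and> \<pi> ` C = A} = card {\<pi>. \<pi> permutes S \<and> \<pi> ` C = A'}"
proof -
  obtain \<sigma> where \<sigma>: "\<sigma> permutes S" "\<sigma> ` A = A'"
    using ex_permutes_image_eq[of S A A'] assms by (auto simp: nsets_def)
  then have inv: "inv \<sigma> permutes S" "inv \<sigma> ` A' = A"
    using permutes_inv[OF \<sigma>(1)] image_inv_f_f[OF permutes_inj[OF \<sigma>(1)]] by auto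
  have "bij_betw (\<lambda>\<pi>. \<sigma> \<circ> \<pi>) {\<pi>. \<pi> permutes S \<and> \<pi> ` C = A} {\<pi>. \<pi> permutes S \<and> \<pi> ` C = A'}"
  proof (rule bij_betwI[where g = "\<lambda>\<pi>. inv \<sigma> \<circ> \<pi>"])
    show "inv \<sigma> \<circ> (\<sigma> \<circ> \<pi>) = \<pi>" "\<sigma> \<circ> (inv \<sigma> \<circ> \<pi>) = \<pi>" for \<pi> :: "'a \<Rightarrow> 'a"
      using permutes_inv_o[OF \<sigma>(1)] by (simp_all add: o_assoc)
  qed (use \<sigma> inv permutes_compose in \<open>metis (mono_tags, lifting) Pi_I image_comp mem_Collect_eq\<close>)+
  then show ?thesis by (rule bij_betw_same_card)
qed

text \<open>The image of \<open>C\<close> under a uniformly random permutation is uniform on the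
  \<open>k\<close>-subsets of \<open>S\<close>; the equation says this with the denominators
  cleared.\<close>

lemma card_permutes_image_in:
  assumes S: "finite S" and C: "C \<in> nsets S k" and B: "B \<subseteq> nsets S k"
  shows "(card S choose k) * card {\<pi>. \<pi> permutes S \<and> \<pi> ` C \<in> B} = card B * fact (card S)"
proof -
  define c where "c = card {\<pi>. \<pi> permutes S \<and> \<pi> ` C = C}"
  have finN: "finite (nsets S k)" using S by (rule finite_imp_finite_nsets)
  \<comment> \<open>Used twice: with all of \<open>nsets S k\<close> for \<open>F\<close> it
    determines the fibre size \<open>c\<close>, and with \<open>B\<close> it gives the
    claim.\<close>
  have count: "card {\<pi>. \<pi> permutes S \<and> \<pi> ` C \<in> F} = card F * c" if "F \<subseteq> nsets S k" for F
  proof -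
    have "{\<pi>. \<pi> permutes S \<and> \<pi> ` C \<in> F} = (\<Union>A\<in>F. {\<pi>. \<pi> permutes S \<and> \<pi> ` C = A})"
      by auto
    also have "card \<dots> = (\<Sum>A\<in>F. card {\<pi>. \<pi> permutes S \<and> \<pi> ` C = A})"
      by (rule card_UN_disjoint)
        (use that finN finite_permutations[OF S] in \<open>auto intro: finite_subset\<close>)
    also have "\<dots> = (\<Sum>A\<in>F. c)"
      unfolding c_def using that by (intro sum.cong refl card_permutes_image_eq[OF S _ C]) auto
    finally show ?thesis by simp
  qed
  have "\<pi> ` C \<in> nsets S k" if "\<pi> permutes S" for \<pi>
  proof -
    have "\<pi> ` C \<subseteq> S" using C permutes_image[OF that] by (auto simp: nsets_def)
    moreover have "card (\<pi> ` C) = card C"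
      by (rule card_image) (rule permutes_inj_on[OF that])
    ultimately show ?thesis using C by (simp add: nsets_def)
  qed
  then have "{\<pi>. \<pi> permutes S \<and> \<pi> ` C \<in> nsets S k} = {\<pi>. \<pi> permutes S}" by blast
  then have "fact (card S) = (card S choose k) * c"
    using count[OF subset_refl] card_permutations[OF refl S] by simp
  then show ?thesis using count[OF B] by simp
qed

text \<open>This is the bound for one fixed position of the disjoint sets, before averaging.\<close>

lemma weighted_hits_le:
  fixes p :: "nat \<Rightarrow> real"
  assumes p: "\<And>i. i \<le> s \<Longrightarrow> p i \<ge> 0"
    and t: "\<And>i. 1 \<le> i \<Longrightarrow> i \<le> s \<Longrightarrow> real i * (\<Sum>j=0..i. p j) \<le> real t * (\<Sum>j=1..i. p j)"
    and B: "mono_on {0..s} B" and ov: "overlapping s B"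
    and D: "disjoint_family_on D {..<t}"
  shows "(\<Sum>i=0..s. p i * real (card {j\<in>{..<t}. D j \<in> B i})) \<le> real t * (\<Sum>i=1..s. p i)"
proof -
  let ?b = "\<lambda>i. card {j\<in>{..<t}. D j \<in> B i}"
  obtain i where i: "i \<le> s" "?b i \<le> i"
    using overlapping_few_hits[OF ov D] by blast
  have low: "?b j \<le> i" if "j \<le> i" for j
  proof -
    have "B j \<subseteq> B i" using monotone_onD[OF B, of j i] that i(1) by simp
    then have "?b j \<le> ?b i" by (intro card_mono) auto
    with i(2) show ?thesis by simp
  qed
  have high: "?b j \<le> t" for j
    using card_mono[of "{..<t}" "{j'\<in>{..<t}. D j' \<in> B j}"] by auto
  \<comment> \<open>The bound \<open>m \<le> Suc i\<close> admits \<open>m = 1\<close> with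
    \<open>i = 0\<close>, where the first sum is empty.\<close>
  have split: "(\<Sum>j=m..s. g j) = (\<Sum>j=m..i. g j) + (\<Sum>j=Suc i..s. g j)" if "m \<le> Suc i"
    for m and g :: "nat \<Rightarrow> real"
    using sum.ub_add_nat[of m i g "s - i"] that i(1) by simp
  have "(\<Sum>j=0..s. p j * real (?b j))
      = (\<Sum>j=0..i. p j * real (?b j)) + (\<Sum>j=Suc i..s. p j * real (?b j))"
    by (rule split) simp
  also have "\<dots> \<le> (\<Sum>j=0..i. p j * real i) + (\<Sum>j=Suc i..s. p j * real t)"
    by (intro add_mono sum_mono mult_left_mono) (use low high p i(1) in auto)
  also have "\<dots> = real i * (\<Sum>j=0..i. p j) + real t * (\<Sum>j=Suc i..s. p j)"
    by (simp add: sum_distrib_left mult.commute)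
  \<comment> \<open>For \<open>i = 0\<close> the hypothesis on \<open>t\<close> says nothing, but
    then the first summand vanishes on both sides.\<close>
  also have "\<dots> \<le> real t * (\<Sum>j=1..i. p j) + real t * (\<Sum>j=Suc i..s. p j)"
    using t[of i] i(1) by (cases "i = 0") auto
  also have "\<dots> = real t * (\<Sum>j=1..s. p j)"
    by (subst split[of 1]) (simp_all add: distrib_left)
  finally show ?thesis .
qed

lemma weighted_card_le:
  fixes p :: "nat \<Rightarrow> real"
  assumes p: "\<And>i. i \<le> s \<Longrightarrow> p i \<ge> 0"
    and t: "\<And>i. 1 \<le> i \<Longrightarrow> i \<le> s \<Longrightarrow> real i * (\<Sum>j=0..i. p j) \<le> real t * (\<Sum>j=1..i. p j)"
    and B: "mono_on {0..s} B" "\<And>i. i \<le> s \<Longrightarrow> B i \<subseteq> nsets S k" and ov: "overlapping s B"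
    and S: "finite S" and "t > 0"
    and D: "disjoint_family_on D {..<t}" "\<And>j. j < t \<Longrightarrow> D j \<in> nsets S k"
  shows "(\<Sum>i=0..s. p i * real (card (B i))) \<le> (\<Sum>i=1..s. p i) * real (card S choose k)"
proof -
  let ?P = "{\<pi>. \<pi> permutes S}" and ?N = "real (card S choose k)"
  have finP: "finite ?P" using S by (rule finite_permutations)
  have swap: "(\<Sum>\<pi>\<in>?P. real (card {j\<in>{..<t}. \<pi> ` D j \<in> B i}))
      = (\<Sum>j<t. real (card {\<pi>. \<pi> permutes S \<and> \<pi> ` D j \<in> B i}))" for i
  proof -
    have "(\<Sum>\<pi>\<in>?P. card {j\<in>{..<t}. \<pi> ` D j \<in> B i})
        = (\<Sum>\<pi>\<in>?P. \<Sum>j<t. if \<pi> ` D j \<in> B i then 1 else 0)"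
      by (simp add: sum.If_cases Int_def)
    also have "\<dots> = (\<Sum>j<t. \<Sum>\<pi>\<in>?P. if \<pi> ` D j \<in> B i then 1 else 0)"
      by (rule sum.swap)
    also have "\<dots> = (\<Sum>j<t. card {\<pi>. \<pi> permutes S \<and> \<pi> ` D j \<in> B i})"
      using finP by (simp add: sum.If_cases Int_def)
    finally show ?thesis by (simp only: of_nat_sum [symmetric])
  qed
  have avg: "?N * (\<Sum>\<pi>\<in>?P. real (card {j\<in>{..<t}. \<pi> ` D j \<in> B i}))
      = real t * fact (card S) * real (card (B i))" if "i \<le> s" for i
  proof -
    have "?N * real (card {\<pi>. \<pi> permutes S \<and> \<pi> ` D j \<in> B i})
        = fact (card S) * real (card (B i))" if "j < t" for j
      using arg_cong[OF card_permutes_image_in[OF S D(2)[OF that] B(2)[OF \<open>i \<le> s\<close>]], of real]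
      by (simp add: mult.commute)
    then show ?thesis unfolding swap sum_distrib_left by simp
  qed
  have hits: "(\<Sum>i=0..s. p i * real (card {j\<in>{..<t}. \<pi> ` D j \<in> B i}))
      \<le> real t * (\<Sum>i=1..s. p i)" if "\<pi> permutes S" for \<pi>
  proof (rule weighted_hits_le[OF p t B(1) ov])
    show "disjoint_family_on (\<lambda>j. \<pi> ` D j) {..<t}"
      using D(1) permutes_inj[OF that] unfolding disjoint_family_on_def
      by (simp add: image_Int [symmetric])
  qed
  \<comment> \<open>The claim is proved multiplied by \<open>t\<close> times the number of
    permutations, a positive factor cancelled at the end.\<close>
  have "real t * fact (card S) * (\<Sum>i=0..s. p i * real (card (B i)))
      = (\<Sum>i=0..s. p i * (real t * fact (card S) * real (card (B i))))"
    by (simp add: sum_distrib_left mult.left_commute)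
  also have "\<dots> = (\<Sum>i=0..s. p i * (?N * (\<Sum>\<pi>\<in>?P. real (card {j\<in>{..<t}. \<pi> ` D j \<in> B i}))))"
    by (intro sum.cong refl) (simp only: avg atLeastAtMost_iff)
  also have "\<dots> = ?N * (\<Sum>\<pi>\<in>?P. \<Sum>i=0..s. p i * real (card {j\<in>{..<t}. \<pi> ` D j \<in> B i}))"
    unfolding sum_distrib_left by (subst sum.swap) (simp add: mult.left_commute)
  also have "\<dots> \<le> ?N * (\<Sum>\<pi>\<in>?P. real t * (\<Sum>i=1..s. p i))"
    by (intro mult_left_mono sum_mono hits) auto
  also have "\<dots> = real t * fact (card S) * ((\<Sum>i=1..s. p i) * ?N)"
    using card_permutations[OF refl S] by simp
  finally show ?thesis using \<open>t > 0\<close> by (simp add: mult_le_cancel_left)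
qed

lemma disjoint_family_on_blocks:
  fixes k :: nat
  shows "disjoint_family_on (\<lambda>j. {j * k + 1..Suc j * k}) T"
proof -
  have "{i * k + 1..Suc i * k} \<inter> {j * k + 1..Suc j * k} = {}" if "i < j" for i j
  proof -
    have "Suc i * k \<le> j * k" using that by (intro mult_le_mono1) simp
    then show ?thesis by auto
  qed
  then show ?thesis
    unfolding disjoint_family_on_def by (metis Int_commute linorder_neqE_nat)
qed

theorem theorem1p6:
  fixes n k s :: nat and p :: "nat \<Rightarrow> real"
  assumes "n > 0" and "k > 0" and "s > 0"
    and "antimono_on {0..s} p" and "p s > 0"
    and "int n \<ge> max (int ((s + 1) * k)) (\<lceil>d_weighted p s\<rceil> * int k)"
  shows "f_weighted p n k s = (\<Sum>i=1..s. p i) * real (n choose k)"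
proof -
  \<comment> \<open>Every weight is at least the last one, which is positive.\<close>
  have pos: "p i > 0" if "i \<le> s" for i
    using monotone_onD[OF assms(4), of i s] that assms(5) by simp
  define t where "t = n div k"
  have "(s + 1) * k \<le> n" using assms(6) by linarith
  then have "s + 1 \<le> t" unfolding t_def using assms(2) by (simp add: less_eq_div_iff_mult_less_eq)
  then have "t > 0" by simp
  \<comment> \<open>The ceiling is an integer, so rounding \<open>n / k\<close> down to
    \<open>t\<close> keeps it a lower bound.\<close>
  have "\<lceil>d_weighted p s\<rceil> \<le> int n div int k"
    using zdiv_mono1[of "\<lceil>d_weighted p s\<rceil> * int k" "int n" "int k"] assms(2,6) by simp
  then have d: "d_weighted p s \<le> real t"
    unfolding t_def by (simp add: ceiling_le_iff zdiv_int [symmetric])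
  have t: "real i * (\<Sum>j=0..i. p j) \<le> real t * (\<Sum>j=1..i. p j)" if i: "1 \<le> i" "i \<le> s" for i
  proof -
    have "(\<Sum>j=1..i. p j) > 0" using i by (intro sum_pos pos) auto
    moreover have "real i * (\<Sum>j=0..s. p j) / (\<Sum>j=1..i. p j) \<le> real t"
      using d Max_ge[of "(\<lambda>i. real i * (\<Sum>j=0..s. p j) / (\<Sum>j=1..i. p j)) ` {1..s}"] i
      unfolding d_weighted_def by fastforce
    ultimately have "real i * (\<Sum>j=0..s. p j) \<le> real t * (\<Sum>j=1..i. p j)"
      by (simp add: divide_le_eq)
    \<comment> \<open>The numerator in \<open>d_weighted\<close> runs up to \<open>s\<close>;
      dropping the positive terms beyond \<open>i\<close> leaves the inequality that the averaging
      uses.\<close>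
    moreover have "(\<Sum>j=0..i. p j) \<le> (\<Sum>j=0..s. p j)"
      by (rule sum_mono2) (use i pos in \<open>auto intro: less_imp_le\<close>)
    ultimately show ?thesis
      by (meson mult_left_mono of_nat_0_le_iff order_trans)
  qed
  have blocks: "{j * k + 1..Suc j * k} \<in> nsets {1..n} k" if "j < t" for j
  proof -
    have "Suc j * k \<le> t * k" using that by (intro mult_le_mono1) simp
    also have "\<dots> \<le> n" unfolding t_def by simp
    finally show ?thesis by (auto simp: nsets_def)
  qed
  show ?thesis
    unfolding f_weighted_def
  proof (rule Max_eqI[OF f_weighted_values(1)], safe)
    fix B :: "nat \<Rightarrow> nat set set"
    assume B: "mono_on {0..s} B" "\<forall>i\<in>{0..s}. B i \<subseteq> nsets {1..n} k" "overlapping s B"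
    then show "(\<Sum>i=0..s. p i * real (card (B i))) \<le> (\<Sum>i=1..s. p i) * real (n choose k)"
      using weighted_card_le[where p = p and S = "{1..n}" and B = B,
          OF _ t B(1) _ B(3) _ \<open>t > 0\<close> disjoint_family_on_blocks blocks] pos
      by (auto intro: less_imp_le)
  next
    let ?B = "\<lambda>i::nat. if i = 0 then {} else nsets {1..n} k"
    have "(\<Sum>i=0..s. p i * real (card (?B i))) = (\<Sum>i=1..s. p i * real (card (?B i)))"
      by (simp add: sum.atLeast_Suc_atMost)
    also have "\<dots> = (\<Sum>i=1..s. p i) * real (n choose k)"
      unfolding sum_distrib_right by (intro sum.cong) auto
    finally have val: "(\<Sum>i=1..s. p i) * real (n choose k) = (\<Sum>i=0..s. p i * real (card (?B i)))"
      by simp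
    have "mono_on {0..s} ?B" by (rule monotone_onI) auto
    moreover have "overlapping s ?B" by (auto simp: overlapping_iff)
    ultimately show "\<exists>B. (\<Sum>i=1..s. p i) * real (n choose k) = (\<Sum>i=0..s. p i * real (card (B i)))
        \<and> mono_on {0..s} B \<and> (\<forall>i\<in>{0..s}. B i \<subseteq> nsets {1..n} k) \<and> overlapping s B"
      using val by (intro exI[of _ ?B]) auto
  qed
qed

end
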